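(* For every $n\ge 1$, $$\sum_{F\in PF(n)}\prod_{h\in\mathcal{H}(F)}B_h=\frac{(-1)^n}{(n+1)!},$$ where $B_h$ is the $h$-th Bernoulli number.
   Context: Bernoulli numbers are defined by $\frac{x}{e^x-1}=\sum_{n\ge0}B_n\frac{x^n}{n!}$ (so $B_1=-1/2$). A plane tree is a rooted unlabeled tree in which the (nonempty) subtrees of each vertex are arranged in linear order; a plane forest is a linearly ordered sequence of plane trees; $PF(n)$ is the set of plane forests with $n$ vertices. For a vertex $u$ of a forest $F$, the hook length $h_u$ is the number of descendants of $u$ (counting $u$ itself), and $\mathcal{H}(F)$ is the multiset of hook lengths of all vertices; the product is over all vertices. *)

theory Defs
  imports "HOL-Computational_Algebra.Computational_Algebra" "HOL-Library.Multiset"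
begin

text \<open>
  The quotient is one of formal power series: both \<^term>\<open>fps_X :: rat fps\<close> and
  \<^term>\<open>fps_exp 1 - 1 :: rat fps\<close> have subdegree 1, so it is the exact quotient
  (see \<open>bernoulli_fps_mult\<close> below).
\<close>

definition bernoulli_fps :: "rat fps" where
  "bernoulli_fps = fps_X / (fps_exp 1 - 1)"

definition bernoulli :: "nat \<Rightarrow> rat" where
  "bernoulli n = fact n * fps_nth bernoulli_fps n"

lemma bernoulli_fps_mult: "bernoulli_fps * (fps_exp 1 - 1) = fps_X"
proof -
  have nz: "fps_exp 1 - 1 \<noteq> (0 :: rat fps)"
  proof
    assume "fps_exp 1 - 1 = (0 :: rat fps)"
    then have "fps_nth (fps_exp 1 - 1 :: rat fps) 1 = 0" by simp
    then show False by simp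
  qed
  have "subdegree (fps_exp 1 - 1 :: rat fps) = 1"
    by (rule subdegreeI) auto
  then have "subdegree (fps_exp 1 - 1 :: rat fps) \<le> subdegree (fps_X :: rat fps)"
    by simp
  then have "(fps_exp 1 - 1 :: rat fps) dvd fps_X"
    using nz by (simp add: fps_dvd_iff)
  then show ?thesis
    unfolding bernoulli_fps_def by simp
qed

lemma bernoulli_egf: "bernoulli_fps = Abs_fps (\<lambda>n. bernoulli n / fact n)"
  by (rule fps_ext) (simp add: bernoulli_def)

text \<open>
  A plane tree is a root together with the linearly ordered list of its (nonempty) subtrees;
  a plane forest is a list of plane trees.
\<close>

datatype plane_tree = Node "plane_tree list"

type_synonym plane_forest = "plane_tree list"

text \<open>
  The vertices of a tree correspond to the elements, with multiplicity, of the multiset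
  of the full subtrees \<open>t\<^sub>u\<close> rooted at its vertices \<open>u\<close>; the vertices of \<open>t\<^sub>u\<close> are exactly
  the descendants of \<open>u\<close>, including \<open>u\<close> itself.
\<close>

primrec subtrees :: "plane_tree \<Rightarrow> plane_tree multiset" where
  "subtrees (Node ts) = add_mset (Node ts) (sum_list (map subtrees ts))"

definition num_vertices :: "plane_tree \<Rightarrow> nat" where
  "num_vertices t = size (subtrees t)"

definition forest_vertices :: "plane_forest \<Rightarrow> nat" where
  "forest_vertices F = sum_list (map num_vertices F)"

definition hook_lengths :: "plane_forest \<Rightarrow> nat multiset" where
  "hook_lengths F = image_mset num_vertices (sum_list (map subtrees F))"

definition PF :: "nat \<Rightarrow> plane_forest set" where
  "PF n = {F. forest_vertices F = n}"

lemma num_vertices_Node: "num_vertices (Node ts) = Suc (forest_vertices ts)"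
proof -
  have "size (sum_list (map subtrees ts)) = sum_list (map num_vertices ts)"
    by (induction ts) (simp_all add: num_vertices_def)
  then show ?thesis
    by (simp add: num_vertices_def forest_vertices_def)
qed

lemma PF_0: "PF 0 = {[]}"
proof -
  have "F = []" if "forest_vertices F = 0" for F
  proof (cases F)
    case (Cons t ts)
    then show ?thesis
      using that by (cases t) (simp add: forest_vertices_def num_vertices_Node)
  qed simp
  then show ?thesis
    by (auto simp: PF_def forest_vertices_def)
qed

lemma finite_PF: "finite (PF n)"
proof (induction n rule: less_induct)
  case (less n)
  have "PF n \<subseteq> insert [] (\<Union>k<n. \<Union>m<n. (\<lambda>(ts, F). Node ts # F) ` (PF k \<times> PF m))"
  proof
    fix F assume F: "F \<in> PF n"
    show "F \<in> insert [] (\<Union>k<n. \<Union>m<n. (\<lambda>(ts, F). Node ts # F) ` (PF k \<times> PF m))"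
    proof (cases F)
      case (Cons t G)
      obtain ts where t: "t = Node ts" by (cases t)
      have eq: "Suc (forest_vertices ts) + forest_vertices G = n"
        using F Cons t by (simp add: PF_def forest_vertices_def num_vertices_Node)
      have "(ts, G) \<in> PF (forest_vertices ts) \<times> PF (forest_vertices G)"
        by (simp add: PF_def)
      moreover have "forest_vertices ts < n" "forest_vertices G < n"
        using eq by auto
      ultimately show ?thesis
        using Cons t by fastforce
    qed simp
  qed
  moreover have "finite (insert [] (\<Union>k<n. \<Union>m<n. (\<lambda>(ts, F). Node ts # F) ` (PF k \<times> PF m)))"
    using less.IH by auto
  ultimately show ?case
    by (rule finite_subset)
qed

end

theory Submission
  imports Defs
begin

text \<open>
  Splitting a nonempty forest into the children of its first root and its remaining trees gives
  \<open>f n = (\<Sum>k=1..n. B k * f (k - 1) * f (n - k))\<close> for the sums in question.  For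
  \<open>f n = (-1) ^ n / (n + 1)!\<close> the signs on the right collect to \<open>(-1) ^ (n - 1)\<close>, and
  the recurrence becomes the vanishing of the coefficient of \<open>x ^ (n + 1)\<close> in
  \<open>(\<Sum>k. B k * x ^ k / k!) * (e ^ x - 1) = x\<close>.
\<close>

definition hook_weight :: "(nat \<Rightarrow> 'a :: comm_monoid_mult) \<Rightarrow> plane_forest \<Rightarrow> 'a" where
  "hook_weight w F = (\<Prod>h\<in>#hook_lengths F. w h)"

lemma hook_weight_Nil [simp]: "hook_weight w [] = 1"
  by (simp add: hook_weight_def hook_lengths_def)

lemma hook_weight_Cons:
  "hook_weight w (Node ts # G)
     = w (Suc (forest_vertices ts)) * hook_weight w ts * hook_weight w G"
  by (simp add: hook_weight_def hook_lengths_def num_vertices_Node mult.assoc)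

lemma forest_vertices_Cons:
  "forest_vertices (Node ts # G) = Suc (forest_vertices ts + forest_vertices G)"
  by (simp add: forest_vertices_def num_vertices_Node)

text \<open>Here \<open>k\<close> counts the vertices below the first root. That root's hook length
  \<open>Suc k\<close> is constant on each part of the split, so the sum over pairs
  \<open>(ts, G)\<close> factors, for any weight \<open>w\<close>.\<close>

lemma sum_hook_weight_Suc:
  fixes w :: "nat \<Rightarrow> 'a :: comm_semiring_1"
  shows "(\<Sum>F\<in>PF (Suc n). hook_weight w F)
     = (\<Sum>k\<le>n. w (Suc k) * (\<Sum>F\<in>PF k. hook_weight w F) * (\<Sum>F\<in>PF (n - k). hook_weight w F))"
proof -
  let ?S = "SIGMA k:{..n}. PF k \<times> PF (n - k)"
  have bij: "bij_betw (\<lambda>(k, ts, G). Node ts # G) ?S (PF (Suc n))"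
  proof (rule bij_betw_imageI)
    \<comment> \<open>\<open>Node ts # G\<close> determines \<open>ts\<close> and \<open>G\<close>,
      and \<open>k\<close> is recovered as the vertex count of \<open>ts\<close>.\<close>
    show "inj_on (\<lambda>(k, ts, G). Node ts # G) ?S"
      by (auto simp: inj_on_def PF_def)
    show "(\<lambda>(k, ts, G). Node ts # G) ` ?S = PF (Suc n)"
    proof (intro equalityI subsetI)
      fix F assume "F \<in> (\<lambda>(k, ts, G). Node ts # G) ` ?S"
      then show "F \<in> PF (Suc n)"
        by (auto simp: PF_def forest_vertices_Cons)
    next
      fix F assume F: "F \<in> PF (Suc n)"
      then have "F \<noteq> []"
        by (auto simp: PF_def forest_vertices_def)
      then obtain ts G where eq: "F = Node ts # G"
        by (metis neq_Nil_conv plane_tree.exhaust)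
      then have "(forest_vertices ts, ts, G) \<in> ?S"
        using F by (auto simp: PF_def forest_vertices_Cons)
      then show "F \<in> (\<lambda>(k, ts, G). Node ts # G) ` ?S"
        by (rule rev_image_eqI) (simp add: eq)
    qed
  qed
  have "(\<Sum>F\<in>PF (Suc n). hook_weight w F)
      = (\<Sum>(k, ts, G)\<in>?S. hook_weight w (Node ts # G))"
    by (subst sum.reindex_bij_betw [OF bij, symmetric]) (simp add: case_prod_unfold)
  also have "\<dots> = (\<Sum>k\<le>n. \<Sum>(ts, G)\<in>PF k \<times> PF (n - k). hook_weight w (Node ts # G))"
    by (subst sum.Sigma [symmetric]) (auto simp: finite_PF)
  also have "\<dots> = (\<Sum>k\<le>n. \<Sum>ts\<in>PF k. \<Sum>G\<in>PF (n - k).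
      w (Suc k) * hook_weight w ts * hook_weight w G)"
    by (auto simp: sum.cartesian_product [symmetric] hook_weight_Cons PF_def
        intro!: sum.cong)
  also have "\<dots> = (\<Sum>k\<le>n. w (Suc k) * (\<Sum>F\<in>PF k. hook_weight w F)
      * (\<Sum>F\<in>PF (n - k). hook_weight w F))"
    by (simp only: sum_distrib_left [symmetric] sum_distrib_right [symmetric] mult.assoc)
  finally show ?thesis .
qed

lemma bernoulli_convolution:
  "(\<Sum>k\<le>n. bernoulli k / fact k / fact (Suc n - k)) = (if n = 0 then 1 else 0)"
proof -
  have "(if n = 0 then 1 else 0) = fps_nth (bernoulli_fps * (fps_exp 1 - 1)) (Suc n)"
    by (simp add: bernoulli_fps_mult)
  \<comment> \<open>The convolution runs up to \<open>Suc n\<close>; its last term vanishes because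
    e^x - 1 has constant term 0.\<close>
  also have "\<dots> = (\<Sum>k\<le>n. bernoulli k / fact k / fact (Suc n - k))"
    by (auto simp: fps_mult_nth bernoulli_def atLeast0AtMost intro!: sum.cong)
  finally show ?thesis by simp
qed

lemma bernoulli_0: "bernoulli 0 = 1"
  using bernoulli_convolution [of 0] by simp

text \<open>Since B_0 = 1, the term \<open>k = 0\<close> of the convolution at \<open>Suc n\<close>
  is 1/(n + 2)!; the remaining terms must cancel it.\<close>

lemma bernoulli_convolution_Suc:
  "(\<Sum>k\<le>n. bernoulli (Suc k) / fact (Suc k) / fact (Suc n - k)) = - 1 / fact (n + 2)"
  using bernoulli_convolution [of "Suc n"]
  by (simp add: sum.atMost_Suc_shift bernoulli_0 add_eq_0_iff del: fact_Suc sum.atMost_Suc)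

lemma sum_hook_weight_bernoulli:
  "(\<Sum>F\<in>PF n. hook_weight bernoulli F) = (-1) ^ n / fact (n + 1)"
proof (induction n rule: less_induct)
  case (less n)
  show ?case
  proof (cases n)
    case 0
    then show ?thesis by (simp add: PF_0)
  next
    case (Suc m)
    have "(\<Sum>F\<in>PF n. hook_weight bernoulli F)
        = (\<Sum>k\<le>m. bernoulli (Suc k) * ((-1) ^ k / fact (k + 1))
             * ((-1) ^ (m - k) / fact (m - k + 1)))"
      unfolding Suc sum_hook_weight_Suc
      by (intro sum.cong refl) (simp add: less.IH Suc del: fact_Suc)
    \<comment> \<open>The (k + 1)! contributed by the forest below the root is exactly the
      denominator of B_(k+1) in the generating function.\<close>
    also have "\<dots> = (\<Sum>k\<le>m. (-1) ^ m * (bernoulli (Suc k) / fact (Suc k) / fact (Suc m - k)))"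
    proof (intro sum.cong refl)
      fix k assume "k \<in> {..m}"
      \<comment> \<open>Both equations rely on k \<le> m, since subtraction of naturals
        truncates.\<close>
      then have "(-1) ^ m = (-1 :: rat) ^ k * (-1) ^ (m - k)" "Suc m - k = m - k + 1"
        by (simp_all flip: power_add)
      then show "bernoulli (Suc k) * ((-1) ^ k / fact (k + 1)) * ((-1) ^ (m - k) / fact (m - k + 1))
          = (-1) ^ m * (bernoulli (Suc k) / fact (Suc k) / fact (Suc m - k))"
        by (simp del: fact_Suc)
    qed
    \<comment> \<open>The sum equals -1/(m + 2)!: its sign completes (-1)^m to (-1)^n, and m + 2 = n
      + 1.\<close>
    also have "\<dots> = (-1) ^ n / fact (n + 1)"
      unfolding sum_distrib_left [symmetric] bernoulli_convolution_Suc
      by (simp add: Suc del: fact_Suc)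
    finally show ?thesis .
  qed
qed

theorem theorem3p6:
  fixes n :: nat
  assumes "n \<ge> 1"
  shows "(\<Sum>F\<in>PF n. \<Prod>h\<in>#hook_lengths F. bernoulli h) = (-1) ^ n / fact (n + 1)"
  using sum_hook_weight_bernoulli [of n] by (simp add: hook_weight_def)

end
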